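(* If $\mathcal{C}$ is a strongly Polishable class of compacta, then for every Polish space $X$ the set $\{K\in\mathcal{K}(X): K \text{ is homeomorphic to a member of } \mathcal{C}\}$ is an analytic subset of $\mathcal{K}(X)$.
   Context: Two classes $\mathcal{C},\mathcal{D}$ of topological spaces (not necessarily closed under homeomorphic copies) are equivalent, written $\mathcal{C}\cong\mathcal{D}$, if every space in $\mathcal{C}$ is homeomorphic to a space in $\mathcal{D}$ and vice versa. A family of subsets of a topological space is regarded as a class of topological spaces by giving each member the subspace topology. A class $\mathcal{C}$ is strongly Polishable if there is a continuous map $q\colon A\to B$ between Polish spaces (possibly empty) such that $q$ is a closed and open map, $|B\setminus q[A]|\le 1$, and $\{q^{-1}(b): b\in B\}\cong\mathcal{C}$; "class of compacta" means that all members are compact. For a Polish space $X$, $\mathcal{K}(X)$ is the hyperspace of all compact subsets of $X$ (including $\emptyset$) with the Vietoris topology, generated by the sets $\{K: K\cap U\neq\emptyset\}$ and $\{K: K\subseteq U\}$ for $U\subseteq X$ open; it is a Polish space. *)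

theory Defs
  imports "HOL-Analysis.Analysis"
begin

text \<open>Spaces are values of type \<^typ>\<open>'a topology\<close>, whose carrier \<^const>\<open>topspace\<close> may be
  empty or a proper subset of the type; a class of spaces is a set of such values.\<close>

definition Polish_space :: "'a topology \<Rightarrow> bool"
  where "Polish_space X \<longleftrightarrow> completely_metrizable_space X \<and> separable_space X"

definition equivalent_classes :: "'a topology set \<Rightarrow> 'b topology set \<Rightarrow> bool"
  where "equivalent_classes \<C> \<D> \<longleftrightarrow>
    (\<forall>X\<in>\<C>. \<exists>Y\<in>\<D>. X homeomorphic_space Y) \<and> (\<forall>Y\<in>\<D>. \<exists>X\<in>\<C>. Y homeomorphic_space X)"

definition fibres :: "'a topology \<Rightarrow> 'b topology \<Rightarrow> ('a \<Rightarrow> 'b) \<Rightarrow> 'a topology set"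
  where "fibres A B q = (\<lambda>b. subtopology A {a \<in> topspace A. q a = b}) ` topspace B"

definition strong_Polish_presentation ::
    "'a topology \<Rightarrow> 'b topology \<Rightarrow> ('a \<Rightarrow> 'b) \<Rightarrow> 'c topology set \<Rightarrow> bool"
  where "strong_Polish_presentation A B q \<C> \<longleftrightarrow>
    Polish_space A \<and> Polish_space B \<and>
    continuous_map A B q \<and> closed_map A B q \<and> open_map A B q \<and>
    finite (topspace B - q ` topspace A) \<and> card (topspace B - q ` topspace A) \<le> 1 \<and>
    equivalent_classes (fibres A B q) \<C>"

text \<open>An existential over Polish spaces in a definition has to range over topologies on one
  fixed type. The type \<^typ>\<open>nat set\<close> is large enough: by the lemma
  \<open>Polish_space_nat_set_copy\<close> below, every Polish space is homeomorphic to one whose points are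
  sets of natural numbers. The topologies are arbitrary and unrelated to any standard topology on
  \<^typ>\<open>nat set\<close>. The lemmas \<open>strongly_PolishableI\<close> and \<open>analytic_inI\<close> show that witnesses on
  arbitrary types are covered.\<close>

definition strongly_Polishable :: "'c topology set \<Rightarrow> bool"
  where "strongly_Polishable \<C> \<longleftrightarrow>
    (\<exists>(A :: nat set topology) (B :: nat set topology) q. strong_Polish_presentation A B q \<C>)"

definition analytic_in :: "'a topology \<Rightarrow> 'a set \<Rightarrow> bool"
  where "analytic_in Y S \<longleftrightarrow>
    (\<exists>(Z :: nat set topology) f. Polish_space Z \<and> continuous_map Z Y f \<and> f ` topspace Z = S)"

text \<open>The carrier of the hyperspace consists of all compact subsets of \<open>X\<close>, including \<open>{}\<close>
  (take \<open>U = topspace X\<close> in the second family).\<close>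

definition Vietoris :: "'a topology \<Rightarrow> 'a set topology"
  where "Vietoris X = topology_generated_by
    ({{K. compactin X K \<and> K \<inter> U \<noteq> {}} | U. openin X U} \<union>
     {{K. compactin X K \<and> K \<subseteq> U} | U. openin X U})"

lemma topspace_Vietoris: "topspace (Vietoris X) = {K. compactin X K}"
proof (intro equalityI subsetI)
  fix K assume "K \<in> {K. compactin X K}"
  then have "K \<in> {K. compactin X K \<and> K \<subseteq> topspace X}"
    using compactin_subset_topspace by blast
  then show "K \<in> topspace (Vietoris X)"
    unfolding Vietoris_def topology_generated_by_topspace using openin_topspace by blast
next
  fix K assume "K \<in> topspace (Vietoris X)"
  then show "K \<in> {K. compactin X K}"
    unfolding Vietoris_def topology_generated_by_topspace by blast
qed

lemma homeomorphic_Polish_space: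
  assumes "X homeomorphic_space Y"
  shows "Polish_space X \<longleftrightarrow> Polish_space Y"
  unfolding Polish_space_def
  using homeomorphic_completely_metrizable_space[OF assms] homeomorphic_separable_space[OF assms]
  by simp

lemma Polish_space_inj_nat_set:
  assumes "Polish_space X"
  shows "\<exists>e :: 'a \<Rightarrow> nat set. inj_on e (topspace X)"
proof -
  obtain M d where M: "Metric_space M d" and X: "X = Metric_space.mtopology M d"
    using assms unfolding Polish_space_def completely_metrizable_space_def by blast
  interpret Metric_space M d by (rule M)
  have top: "topspace X = M" by (simp add: X)
  obtain C where C: "countable C" "C \<subseteq> M" "X closure_of C = M"
    using assms top unfolding Polish_space_def separable_space_def by auto
  define e where "e x = {n. case prod_decode n of (i, k) \<Rightarrow>
      d (from_nat_into C i) x < inverse (real (Suc k))}" for x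
  have "x = y" if x: "x \<in> M" and y: "y \<in> M" and eq: "e x = e y" for x y
  proof (rule ccontr)
    assume "x \<noteq> y"
    then have "0 < d x y / 2" using x y by (simp add: mdist_pos_less)
    then obtain k where k: "inverse (real (Suc k)) < d x y / 2"
      using reals_Archimedean by blast
    have "x \<in> mtopology closure_of C" using C x X by simp
    then obtain c where c: "c \<in> C" "c \<in> mball x (inverse (real (Suc k)))"
      unfolding metric_closure_of mem_Collect_eq
    by (metis in_mball of_nat_0_less_iff positive_imp_inverse_positive zero_less_Suc)
    have cM: "c \<in> M" using c C by blast
    obtain i where i: "from_nat_into C i = c"
      using from_nat_into_surj[OF C(1) c(1)] by blast
    have dx: "d c x < inverse (real (Suc k))" using c by (simp add: commute)
    then have "prod_encode (i, k) \<in> e x" by (simp add: e_def i)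
    then have "prod_encode (i, k) \<in> e y" using eq by simp
    then have dy: "d c y < inverse (real (Suc k))" by (simp add: e_def i)
    have "d x y \<le> d c x + d c y" using triangle[OF x cM y] by (simp add: commute)
    then show False using dx dy k by linarith
  qed
  then show ?thesis using top by (auto simp: inj_on_def)
qed

lemma homeomorphic_nat_set_copy:
  fixes e :: "'a \<Rightarrow> 'b"
  assumes "inj_on e (topspace X)"
  shows "X homeomorphic_space
    pullback_topology (e ` topspace X) (inv_into (topspace X) e) X"
    (is "_ homeomorphic_space ?Y")
proof -
  let ?g = "inv_into (topspace X) e"
  have gf: "?g (e x) = x" if "x \<in> topspace X" for x
    using assms that by (rule inv_into_f_f)
  have "continuous_map X X (?g \<circ> e)"
    by (rule continuous_map_eq[OF continuous_map_id]) (simp add: gf)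
  then have 1: "continuous_map X ?Y e"
    by (rule continuous_map_pullback') auto
  have "continuous_map ?Y X (id \<circ> ?g)"
    by (intro continuous_map_pullback continuous_map_id)
  then have 2: "continuous_map ?Y X ?g" by simp
  have "homeomorphic_maps X ?Y e ?g"
    unfolding homeomorphic_maps_def using 1 2 gf
    by (auto simp: topspace_pullback_topology f_inv_into_f)
  then show ?thesis unfolding homeomorphic_space_def by blast
qed

lemma Polish_space_nat_set_copy:
  assumes "Polish_space X"
  shows "\<exists>Y :: nat set topology. Polish_space Y \<and> X homeomorphic_space Y"
proof -
  obtain e :: "'a \<Rightarrow> nat set" where "inj_on e (topspace X)"
    using Polish_space_inj_nat_set[OF assms] by blast
  note hom = homeomorphic_nat_set_copy[OF this]
  then show ?thesis using homeomorphic_Polish_space[OF hom] assms by blast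
qed

lemma analytic_inI:
  assumes Z: "Polish_space Z" and f: "continuous_map Z Y f"
  shows "analytic_in Y (f ` topspace Z)"
proof -
  obtain Z' :: "nat set topology" where Z': "Polish_space Z'" "Z homeomorphic_space Z'"
    using Polish_space_nat_set_copy[OF Z] by blast
  then obtain g h where "homeomorphic_maps Z Z' g h"
    unfolding homeomorphic_space_def by blast
  then have h: "homeomorphic_map Z' Z h"
    using homeomorphic_maps_map by blast
  have "continuous_map Z' Y (f \<circ> h)"
    using h f by (meson continuous_map_compose homeomorphic_imp_continuous_map)
  moreover have "(f \<circ> h) ` topspace Z' = f ` topspace Z"
    using homeomorphic_imp_surjective_map[OF h] by (metis image_comp)
  ultimately show ?thesis unfolding analytic_in_def using Z' by blast
qed

lemma strongly_PolishableI:
  assumes "strong_Polish_presentation A B q \<C>"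
  shows "strongly_Polishable \<C>"
proof -
  have A: "Polish_space A" and B: "Polish_space B" and q: "continuous_map A B q"
    "closed_map A B q" "open_map A B q"
    and fin: "finite (topspace B - q ` topspace A)"
    and card: "card (topspace B - q ` topspace A) \<le> 1"
    and eqv: "equivalent_classes (fibres A B q) \<C>"
    using assms unfolding strong_Polish_presentation_def by auto
  obtain A' :: "nat set topology" where A': "Polish_space A'" "A homeomorphic_space A'"
    using Polish_space_nat_set_copy[OF A] by blast
  obtain B' :: "nat set topology" where B': "Polish_space B'" "B homeomorphic_space B'"
    using Polish_space_nat_set_copy[OF B] by blast
  obtain h where h: "homeomorphic_map A' A h"
    using A'(2) homeomorphic_space homeomorphic_space_sym by metis
  obtain g where g: "homeomorphic_map B B' g"
    using B'(2) homeomorphic_space by metis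
  have himg: "h ` topspace A' = topspace A" and gimg: "g ` topspace B = topspace B'"
    and ginj: "inj_on g (topspace B)"
    using h g by (auto simp: homeomorphic_eq_everything_map)
  define p where "p = g \<circ> (q \<circ> h)"
  have qim: "q ` topspace A \<subseteq> topspace B"
    using q(1) continuous_map_image_subset_topspace by blast
  have p: "continuous_map A' B' p" "closed_map A' B' p" "open_map A' B' p"
    unfolding p_def using q h g
    by (meson continuous_map_compose closed_map_compose open_map_compose
        homeomorphic_imp_continuous_map homeomorphic_imp_closed_map homeomorphic_imp_open_map)+
  have "p ` topspace A' = g ` q ` topspace A"
    by (simp only: p_def image_comp[symmetric] himg)
  then have diff: "topspace B' - p ` topspace A' = g ` (topspace B - q ` topspace A)"
    using inj_on_image_set_diff[OF ginj _ qim, of "topspace B"] gimg by simp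
  have cd: "finite (topspace B' - p ` topspace A')" "card (topspace B' - p ` topspace A') \<le> 1"
    unfolding diff using fin card card_image_le[OF fin, of g] by auto
  have fib: "subtopology A' {a \<in> topspace A'. p a = g b} homeomorphic_space
      subtopology A {a \<in> topspace A. q a = b}" if b: "b \<in> topspace B" for b
  proof -
    have "h x \<in> {a \<in> topspace A. q a = b} \<longleftrightarrow> x \<in> {a \<in> topspace A'. p a = g b}"
      if "x \<in> topspace A'" "h x \<in> topspace A" for x
    proof -
      have "q (h x) \<in> topspace B" using qim that by blast
      then show ?thesis using that b ginj by (auto simp: p_def inj_on_eq_iff)
    qed
    then show ?thesis
      by (rule homeomorphic_map_imp_homeomorphic_space[OF homeomorphic_map_subtopologies_alt[OF h]])
  qed
  have "equivalent_classes (fibres A' B' p) \<C>"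
    unfolding equivalent_classes_def
  proof (intro conjI ballI)
    fix T assume "T \<in> fibres A' B' p"
    then obtain b where b: "b \<in> topspace B" "T = subtopology A' {a \<in> topspace A'. p a = g b}"
      unfolding fibres_def gimg[symmetric] by blast
    have "subtopology A {a \<in> topspace A. q a = b} \<in> fibres A B q"
      unfolding fibres_def using b by blast
    then obtain Y where "Y \<in> \<C>" "subtopology A {a \<in> topspace A. q a = b} homeomorphic_space Y"
      using eqv unfolding equivalent_classes_def by blast
    then show "\<exists>Y\<in>\<C>. T homeomorphic_space Y"
      using homeomorphic_space_trans[OF fib[OF b(1)]] b(2) by blast
  next
    fix Y assume "Y \<in> \<C>"
    then obtain b where b: "b \<in> topspace B"
      "Y homeomorphic_space subtopology A {a \<in> topspace A. q a = b}"
      using eqv unfolding equivalent_classes_def fibres_def by blast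
    have "Y homeomorphic_space subtopology A' {a \<in> topspace A'. p a = g b}"
      using homeomorphic_space_trans[OF b(2)] fib[OF b(1)] homeomorphic_space_sym by metis
    moreover have "subtopology A' {a \<in> topspace A'. p a = g b} \<in> fibres A' B' p"
      unfolding fibres_def using b gimg by blast
    ultimately show "\<exists>T\<in>fibres A' B' p. Y homeomorphic_space T" by blast
  qed
  then show ?thesis
    unfolding strongly_Polishable_def strong_Polish_presentation_def
    using A' B' p cd by blast
qed

end

theory Submission
  imports Defs
begin

text \<open>
  Let \<open>q : A \<rightarrow> B\<close> be a presentation of the class. The set in question consists of the compact
  \<open>K \<subseteq> X\<close> that are homeomorphic to some fibre of \<open>q\<close>, and it suffices to produce all
  nonempty such \<open>K\<close> as values of a continuous map on a Polish space: the empty set is a single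
  point of the hyperspace, and analytic sets are closed under adding a point
  (\<open>analytic_in_insert\<close>).

  No Polish structure on a hyperspace is used. Instead, a nonempty compact set is coded by a dense
  sequence \<open>x\<close> in it, together with a sequence \<open>c\<close> of natural numbers which witnesses that the
  range of \<open>x\<close> is totally bounded: up to distance \<open>1/(n+1)\<close> it is exhausted by the terms with
  index at most \<open>c n\<close>. In a complete metric such a pair always has a compact closure, and because
  the bound \<open>c n\<close> is part of the code and locally constant, the closure depends continuously on
  the code (\<open>continuous_map_closure_range_Vietoris\<close>). Without the second component
  this fails: a small perturbation of a sequence in the product topology controls only
  finitely many terms.

  A homeomorphism between \<open>K\<close> and a fibre of \<open>q\<close> carries \<open>x\<close> to a dense sequence \<open>a\<close> of
  that fibre, and both it and its inverse are uniformly continuous by compactness. Conversely, if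
  the correspondence between \<open>a n\<close> and \<open>x n\<close> is uniformly continuous in both directions, then it
  extends by completeness to a homeomorphism of the closures
  (\<open>modulus_imp_homeomorphic_closures\<close>). Letting \<open>c\<close> serve also as modulus of continuity, the
  relevant codes are the triples \<open>(a, x, c)\<close> such that \<open>c\<close> bounds \<open>x\<close>, is a modulus in both
  directions, and \<open>a\<close> is dense in the fibre through \<open>a 0\<close>. The first conditions are countable
  intersections of open ones. The last one says that \<open>q\<close> is constant on \<open>a\<close>, which is closed,
  and that for each \<open>U\<close> in a countable base of \<open>A\<close>, if \<open>q (a 0)\<close> lies in \<open>q ` U\<close> then
  some \<open>a k\<close> lies in \<open>U\<close>. Since \<open>q\<close> is open, \<open>q ` U\<close> is open, so this is a union of a closed
  and an open condition (\<open>gdelta_in_fills_fibre\<close>). Hence the codes form a \<open>G\<^sub>\<delta>\<close> set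
  in a countable product of Polish spaces, which is itself Polish.
\<close>

section \<open>Polish spaces and analytic sets\<close>

abbreviation sequence_space :: "'a topology \<Rightarrow> (nat \<Rightarrow> 'a) topology"
  where "sequence_space X \<equiv> product_topology (\<lambda>_. X) UNIV"

lemma (in Metric_space) separable_imp_second_countable:
  assumes "separable_space mtopology"
  shows "second_countable mtopology"
proof -
  obtain C where C: "countable C" "C \<subseteq> M" "mtopology closure_of C = M"
    using assms unfolding separable_space_def by auto
  let ?\<B> = "(\<lambda>(c, n). mball c (inverse (Suc n))) ` (C \<times> (UNIV :: nat set))"
  show ?thesis
    unfolding second_countable_def
  proof (intro exI[where x = ?\<B>] conjI allI impI ballI)
    show "countable ?\<B>"
      using C(1) by simp
    show "openin mtopology V" if "V \<in> ?\<B>" for V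
      using that by auto
  next
    fix U x assume Ux: "openin mtopology U \<and> x \<in> U"
    then obtain r where r: "r > 0" "mball x r \<subseteq> U" and xM: "x \<in> M"
      unfolding openin_mtopology by blast
    obtain n where n: "inverse (real (Suc n)) < r / 2"
      using reals_Archimedean[of "r/2"] r by auto
    have "x \<in> mtopology closure_of C" using C xM by simp
    then obtain c where c: "c \<in> C" "c \<in> mball x (inverse (Suc n))"
      unfolding metric_closure_of by (smt (verit, best) mem_Collect_eq of_nat_0_less_iff positive_imp_inverse_positive zero_less_Suc)
    have "x \<in> mball c (inverse (Suc n))" using c by (simp add: commute)
    moreover have "mball c (inverse (Suc n)) \<subseteq> mball x r"
    proof
      fix y assume y: "y \<in> mball c (inverse (Suc n))"
      then have "d x y \<le> d x c + d c y" using c by (intro triangle) auto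
      then have "d x y < r" using c y n by auto
      then show "y \<in> mball x r" using y xM by auto
    qed
    ultimately show "\<exists>V\<in>?\<B>. x \<in> V \<and> V \<subseteq> U"
      using c(1) r(2) by (intro bexI[where x = "mball c (inverse (Suc n))"]) auto
  qed
qed

lemma Polish_space_iff_second_countable:
  "Polish_space X \<longleftrightarrow> completely_metrizable_space X \<and> second_countable X"
proof
  assume X: "Polish_space X"
  then obtain M d where "Metric_space M d" "X = Metric_space.mtopology M d"
    unfolding Polish_space_def completely_metrizable_space_def by blast
  then show "completely_metrizable_space X \<and> second_countable X"
    using X Metric_space.separable_imp_second_countable unfolding Polish_space_def by blast
qed (simp add: Polish_space_def second_countable_imp_separable_space)

lemma second_countable_prod_topology:
  assumes "second_countable X" "second_countable Y"
  shows "second_countable (prod_topology X Y)"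
proof -
  obtain \<B> where \<B>: "countable \<B>" "\<And>V. V \<in> \<B> \<Longrightarrow> openin X V"
    "\<And>U x. openin X U \<Longrightarrow> x \<in> U \<Longrightarrow> (\<exists>V \<in> \<B>. x \<in> V \<and> V \<subseteq> U)"
    using assms(1) unfolding second_countable_def by metis
  obtain \<D> where \<D>: "countable \<D>" "\<And>V. V \<in> \<D> \<Longrightarrow> openin Y V"
    "\<And>U x. openin Y U \<Longrightarrow> x \<in> U \<Longrightarrow> (\<exists>V \<in> \<D>. x \<in> V \<and> V \<subseteq> U)"
    using assms(2) unfolding second_countable_def by metis
  let ?\<E> = "(\<lambda>(U, V). U \<times> V) ` (\<B> \<times> \<D>)"
  show ?thesis
    unfolding second_countable_def
  proof (intro exI[where x = ?\<E>] conjI allI impI ballI)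
    show "countable ?\<E>" using \<B>(1) \<D>(1) by simp
    show "openin (prod_topology X Y) V" if "V \<in> ?\<E>" for V
      using that \<B>(2) \<D>(2) by (auto simp: openin_prod_Times_iff)
  next
    fix W p assume "openin (prod_topology X Y) W \<and> p \<in> W"
    then obtain U V where UV: "openin X U" "openin Y V" "fst p \<in> U" "snd p \<in> V" "U \<times> V \<subseteq> W"
      unfolding openin_prod_topology_alt by (metis prod.collapse)
    obtain U' V' where "U' \<in> \<B>" "fst p \<in> U'" "U' \<subseteq> U" "V' \<in> \<D>" "snd p \<in> V'" "V' \<subseteq> V"
      using \<B>(3)[OF UV(1,3)] \<D>(3)[OF UV(2,4)] by metis
    then show "\<exists>E\<in>?\<E>. p \<in> E \<and> E \<subseteq> W"
      using UV(5) by (intro bexI[where x = "U' \<times> V'"]) (auto simp: mem_Times_iff)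
  qed
qed

text \<open>A basic open box restricts only finitely many coordinates, so it can be taken to be given by a
  finite list of basic open sets, and there are countably many such lists.\<close>

lemma second_countable_sequence_space:
  assumes "second_countable X"
  shows "second_countable (sequence_space X)"
proof -
  obtain \<B> where \<B>: "countable \<B>" "\<And>V. V \<in> \<B> \<Longrightarrow> openin X V"
    "\<And>U x. openin X U \<Longrightarrow> x \<in> U \<Longrightarrow> (\<exists>V \<in> \<B>. x \<in> V \<and> V \<subseteq> U)"
    using assms unfolding second_countable_def by metis
  define box where "box l = Pi\<^sub>E UNIV (\<lambda>i. if i < length l then l ! i else topspace X)" for l
  show ?thesis
    unfolding second_countable_def
  proof (intro exI[where x = "box ` lists \<B>"] conjI allI impI ballI)
    show "countable (box ` lists \<B>)" using \<B>(1) by simp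
  next
    fix V assume "V \<in> box ` lists \<B>"
    then obtain l where l: "V = box l" "\<And>i. i < length l \<Longrightarrow> openin X (l ! i)"
      using \<B>(2) by (auto simp: in_lists_conv_set)
    have "finite {i. (if i < length l then l ! i else topspace X) \<noteq> topspace X}"
      by (rule finite_subset[of _ "{..<length l}"]) (auto split: if_splits)
    then show "openin (sequence_space X) V"
      using l unfolding l(1) box_def openin_PiE_gen by auto
  next
    fix W x assume W: "openin (sequence_space X) W \<and> x \<in> W"
    then obtain U where fin: "finite {i. U i \<noteq> topspace X}" and U: "\<And>i. openin X (U i)"
      and xU: "x \<in> Pi\<^sub>E UNIV U" "Pi\<^sub>E UNIV U \<subseteq> W"
      using W unfolding openin_product_topology_alt by simp blast
    obtain N where N: "\<And>i. U i \<noteq> topspace X \<Longrightarrow> i < N"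
      using finite_nat_set_iff_bounded[of "{i. U i \<noteq> topspace X}"] fin by auto
    have xU_i: "x i \<in> U i" for i using xU(1) by (rule PiE_mem) simp
    obtain V where V: "\<And>i. V i \<in> \<B>" "\<And>i. x i \<in> V i" "\<And>i. V i \<subseteq> U i"
      using \<B>(3)[OF U xU_i] by metis
    let ?l = "map V [0..<N]"
    have "x i \<in> topspace X" for i using xU_i openin_subset[OF U] by blast
    then have "x \<in> box ?l" using V by (auto simp: box_def)
    moreover have "box ?l \<subseteq> W"
    proof -
      have "box ?l \<subseteq> Pi\<^sub>E UNIV U"
        unfolding box_def
      proof (rule PiE_mono)
        show "(if i < length ?l then ?l ! i else topspace X) \<subseteq> U i" for i
          using V(3)[of i] N[of i] by (cases "i < N") auto
      qed
      then show ?thesis using xU(2) by blast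
    qed
    moreover have "?l \<in> lists \<B>" using V by auto
    ultimately show "\<exists>E\<in>box ` lists \<B>. x \<in> E \<and> E \<subseteq> W" by blast
  qed
qed

lemma Polish_space_prod_topology:
  "\<lbrakk>Polish_space X; Polish_space Y\<rbrakk> \<Longrightarrow> Polish_space (prod_topology X Y)"
  by (simp add: Polish_space_iff_second_countable completely_metrizable_space_prod_topology
      second_countable_prod_topology)

lemma Polish_space_sequence_space: "Polish_space X \<Longrightarrow> Polish_space (sequence_space X)"
  by (simp add: Polish_space_iff_second_countable completely_metrizable_space_product_topology
      second_countable_sequence_space)

lemma Polish_space_discrete_topology: "countable U \<Longrightarrow> Polish_space (discrete_topology U)"
  by (simp add: Polish_space_def completely_metrizable_space_discrete_topology
      separable_space_discrete_topology)

lemma Polish_space_gdelta_subtopology: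
  "\<lbrakk>Polish_space X; gdelta_in X S\<rbrakk> \<Longrightarrow> Polish_space (subtopology X S)"
  by (simp add: Polish_space_iff_second_countable completely_metrizable_space_gdelta_in
      second_countable_subtopology)

text \<open>If \<open>S\<close> is the image of \<open>Z\<close>, then the product of \<open>Z\<close> with a two-point space
  maps onto the larger set by sending one copy of \<open>Z\<close> to the new point. This needs \<open>Z\<close> to be
  nonempty, so empty \<open>S\<close> is treated apart.\<close>

lemma analytic_in_insert:
  assumes S: "analytic_in Y S" and p: "p \<in> topspace Y"
  shows "analytic_in Y (insert p S)"
proof (cases "S = {}")
  case True
  have "analytic_in Y ((\<lambda>_::unit. p) ` topspace (discrete_topology UNIV))"
    using p by (intro analytic_inI Polish_space_discrete_topology) auto
  then show ?thesis using True by simp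
next
  case False
  obtain Z :: "nat set topology" and f where Z: "Polish_space Z" "continuous_map Z Y f"
      "f ` topspace Z = S"
    using S unfolding analytic_in_def by blast
  let ?Z = "prod_topology Z (discrete_topology (UNIV :: bool set))"
  define g where "g = (\<lambda>(z, b). if b then f z else p)"
  have "continuous_map ?Z Y g"
  proof (subst continuous_map_def, intro conjI allI impI)
    show "g \<in> topspace ?Z \<rightarrow> topspace Y"
      using p continuous_map_funspace[OF Z(2)] by (auto simp: g_def)
  next
    fix U assume U: "openin Y U"
    have "{z \<in> topspace ?Z. g z \<in> U} =
        {z \<in> topspace Z. f z \<in> U} \<times> {True} \<union> {z \<in> topspace Z. p \<in> U} \<times> {False}"
      by (auto simp: g_def split: if_splits)
    moreover have "openin Z {z \<in> topspace Z. f z \<in> U}"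
      using U Z(2) openin_continuous_map_preimage by blast
    moreover have "openin Z {z \<in> topspace Z. p \<in> U}"
      by (cases "p \<in> U") auto
    ultimately show "openin ?Z {z \<in> topspace ?Z. g z \<in> U}"
      by (auto simp: openin_prod_Times_iff)
  qed
  then have "analytic_in Y (g ` topspace ?Z)"
    using Z by (intro analytic_inI Polish_space_prod_topology Polish_space_discrete_topology) auto
  moreover have "g ` topspace ?Z = insert p S"
  proof -
    have "g ` topspace ?Z = g ` (topspace Z \<times> {True}) \<union> g ` (topspace Z \<times> {False})"
      unfolding image_Un[symmetric] by (rule arg_cong[where f = "image g"]) auto
    also have "g ` (topspace Z \<times> {True}) = S"
    proof -
      have "topspace Z \<times> {True} = (\<lambda>z. (z, True)) ` topspace Z" by auto
      then show ?thesis using Z(3) by (simp add: g_def image_image)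
    qed
    also have "g ` (topspace Z \<times> {False}) = {p}"
      using False Z(3) by (auto simp: g_def image_def)
    finally show ?thesis by simp
  qed
  ultimately show ?thesis by simp
qed

section \<open>Compact sets as closures of coded sequences\<close>

lemma closure_of_mtopology_of:
  "mtopology_of m closure_of S = {x \<in> mspace m. \<forall>r>0. \<exists>y\<in>S \<inter> mspace m. mdist m x y < r}"
  unfolding mtopology_of_def Metric_space.metric_closure_of[OF Metric_space_mspace_mdist]
  by (auto simp: Metric_space.in_mball[OF Metric_space_mspace_mdist])

lemma Hausdorff_space_mtopology_of: "Hausdorff_space (mtopology_of m)"
  using Metric_space.Hausdorff_space_mtopology[OF Metric_space_mspace_mdist]
  by (simp add: mtopology_of_def)

lemma dense_in_closure:
  assumes "S \<subseteq> topspace X"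
  shows "subtopology X (X closure_of S) closure_of S = X closure_of S"
proof -
  have "X closure_of S \<inter> S = S"
    using closure_of_subset[OF assms] by blast
  then show ?thesis by (simp only: closure_of_subtopology Int_absorb)
qed

text \<open>Continuous maps into a Hausdorff space that agree on a dense set are equal; the form below is the
  one that turns mutually inverse correspondences of dense sequences into mutually inverse maps.\<close>

lemma continuous_map_closure_eq_id:
  assumes X: "Hausdorff_space X" and S: "S \<subseteq> topspace X"
    and f: "continuous_map (subtopology X (X closure_of S)) (subtopology X (X closure_of S)) f"
    and id: "\<And>y. y \<in> S \<Longrightarrow> f y = y" and y: "y \<in> X closure_of S"
  shows "f y = y"
proof -
  let ?C = "subtopology X (X closure_of S)"
  have "f y = id y"
  proof (rule forall_in_closure_of_eq[where X = ?C and Y = ?C and S = S and f = f and g = id])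
    show "y \<in> ?C closure_of S" using y by (simp only: dense_in_closure[OF S])
    show "Hausdorff_space ?C" using X by (rule Hausdorff_space_subtopology)
    show "continuous_map ?C ?C f" by (rule f)
    show "continuous_map ?C ?C id" by (rule continuous_map_id)
  qed (simp add: id)
  then show ?thesis by simp
qed

text \<open>Total boundedness of the range of \<open>x\<close>, with an explicit bound on the indices needed for each
  precision. The inequality is strict so that each instance is an open condition on
  \<open>(x, c)\<close>.\<close>

definition uniformly_spread :: "'a metric \<Rightarrow> (nat \<Rightarrow> 'a) \<Rightarrow> (nat \<Rightarrow> nat) \<Rightarrow> bool"
  where "uniformly_spread m x c \<longleftrightarrow> (\<forall>n k. \<exists>j\<le>c n. mdist m (x k) (x j) < inverse (Suc n))"

text \<open>Uniform continuity of the correspondence taking \<open>a j\<close> to \<open>x j\<close>, with \<open>c\<close> as modulus. It is stated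
  as a disjunction of strict inequalities so that each instance is an open condition on
  \<open>(a, x, c)\<close>.\<close>

definition modulus ::
    "'a metric \<Rightarrow> 'b metric \<Rightarrow> (nat \<Rightarrow> 'a) \<Rightarrow> (nat \<Rightarrow> 'b) \<Rightarrow> (nat \<Rightarrow> nat) \<Rightarrow> bool"
  where "modulus m1 m2 a x c \<longleftrightarrow> (\<forall>n j k. mdist m1 (a j) (a k) > inverse (Suc (c n)) \<or>
    mdist m2 (x j) (x k) < inverse (Suc n))"

lemma uniformly_spread_mono:
  assumes "uniformly_spread m x c" "\<And>n. c n \<le> c' n"
  shows "uniformly_spread m x c'"
  unfolding uniformly_spread_def
proof (intro allI)
  fix n k
  obtain j where "j \<le> c n" "mdist m (x k) (x j) < inverse (Suc n)"
    using assms(1) unfolding uniformly_spread_def by blast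
  then show "\<exists>j\<le>c' n. mdist m (x k) (x j) < inverse (Suc n)"
    using assms(2)[of n] by (intro exI[where x = j]) auto
qed

lemma modulus_mono:
  assumes "modulus m1 m2 a x c" "\<And>n. c n \<le> c' n"
  shows "modulus m1 m2 a x c'"
  unfolding modulus_def
proof (intro allI)
  fix n j k
  have "inverse (real (Suc (c' n))) \<le> inverse (real (Suc (c n)))"
    using assms(2)[of n] by (intro le_imp_inverse_le) auto
  moreover have "mdist m1 (a j) (a k) > inverse (Suc (c n)) \<or> mdist m2 (x j) (x k) < inverse (Suc n)"
    using assms(1) unfolding modulus_def by blast
  ultimately show "mdist m1 (a j) (a k) > inverse (Suc (c' n)) \<or> mdist m2 (x j) (x k) < inverse (Suc n)"
    by linarith
qed

lemma uniformly_spread_imp_compactin_closure: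
  assumes m: "mcomplete_of m" and x: "range x \<subseteq> mspace m" and c: "uniformly_spread m x c"
  shows "compactin (mtopology_of m) (mtopology_of m closure_of range x)"
proof -
  interpret Metric_space "mspace m" "mdist m" by (rule Metric_space_mspace_mdist)
  have "mtotally_bounded (range x)"
    unfolding mtotally_bounded_def
  proof (intro allI impI)
    fix e :: real assume "e > 0"
    then obtain n where n: "inverse (real (Suc n)) < e" using reals_Archimedean by blast
    have "range x \<subseteq> (\<Union>y\<in>x ` {..c n}. mball y e)"
    proof
      fix y assume "y \<in> range x"
      then obtain k where k: "y = x k" by blast
      obtain j where "j \<le> c n" "mdist m (x k) (x j) < inverse (Suc n)"
        using c unfolding uniformly_spread_def by blast
      then have "y \<in> mball (x j) e" using x k n by (auto simp: commute)
      then show "y \<in> (\<Union>y\<in>x ` {..c n}. mball y e)" using \<open>j \<le> c n\<close> by blast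
    qed
    then show "\<exists>K. finite K \<and> K \<subseteq> range x \<and> range x \<subseteq> (\<Union>y\<in>K. mball y e)"
      by (intro exI[where x = "x ` {..c n}"]) auto
  qed
  then show ?thesis
    using m mtotally_bounded_eq_compact_closure_of unfolding mcomplete_of_def mtopology_of_def
    by blast
qed

lemma compactin_dense_sequence_uniformly_spread:
  assumes K: "compactin (mtopology_of m) K" and x: "range x \<subseteq> K"
    and dense: "K \<subseteq> mtopology_of m closure_of range x"
  shows "\<exists>c. uniformly_spread m x c"
proof -
  interpret Metric_space "mspace m" "mdist m" by (rule Metric_space_mspace_mdist)
  have KM: "K \<subseteq> mspace m" using compactin_subset_topspace[OF K] by simp
  have "\<exists>N. \<forall>k. \<exists>j\<le>N. mdist m (x k) (x j) < inverse (Suc n)" for n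
  proof -
    let ?U = "\<lambda>j. mball (x j) (inverse (Suc n))"
    have "K \<subseteq> \<Union> (range ?U)"
    proof
      fix y assume y: "y \<in> K"
      then obtain j where "mdist m y (x j) < inverse (Suc n)"
        using dense unfolding closure_of_mtopology_of
        by (smt (verit, ccfv_threshold) IntE inverse_positive_iff_positive mem_Collect_eq of_nat_0_less_iff rangeE subsetD zero_less_Suc)
      then have "y \<in> ?U j" using y KM x by (auto simp: commute)
      then show "y \<in> \<Union> (range ?U)" by blast
    qed
    moreover have "\<And>V. V \<in> range ?U \<Longrightarrow> openin (mtopology_of m) V"
      by (auto simp: mtopology_of_def)
    ultimately obtain \<F> where F: "finite \<F>" "\<F> \<subseteq> range ?U" "K \<subseteq> \<Union> \<F>"
      using K unfolding compactin_def by metis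
    then obtain J where J: "finite J" "\<F> = ?U ` J"
      by (metis finite_subset_image)
    obtain N where N: "\<And>j. j \<in> J \<Longrightarrow> j \<le> N"
      using J(1) finite_nat_set_iff_bounded_le by auto
    have "\<exists>j\<le>N. mdist m (x k) (x j) < inverse (Suc n)" for k
    proof -
      have "x k \<in> \<Union> (?U ` J)" using x F(3) J(2) by blast
      then show ?thesis using N by (auto simp: commute)
    qed
    then show ?thesis by blast
  qed
  then show ?thesis unfolding uniformly_spread_def by metis
qed

lemma compactin_imp_dense_sequence:
  assumes K: "compactin (mtopology_of m) K" and ne: "K \<noteq> {}"
  obtains x :: "nat \<Rightarrow> 'a" where "range x \<subseteq> K" "mtopology_of m closure_of range x = K"
proof -
  interpret Metric_space "mspace m" "mdist m" by (rule Metric_space_mspace_mdist)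
  have KM: "K \<subseteq> mspace m" using compactin_subset_topspace[OF K] by simp
  have "mtotally_bounded K"
    using K compactin_imp_mtotally_bounded by (simp add: mtopology_of_def)
  then have "\<forall>n. \<exists>F. finite F \<and> F \<subseteq> K \<and> K \<subseteq> (\<Union>y\<in>F. mball y (inverse (Suc n)))"
    unfolding mtotally_bounded_def by simp
  then obtain F where F: "\<And>n. finite (F n)" "\<And>n. F n \<subseteq> K"
      "\<And>n. K \<subseteq> (\<Union>y\<in>F n. mball y (inverse (Suc n)))"
    by metis
  let ?D = "\<Union>n. F n"
  have "?D \<noteq> {}" using ne F(3) by fastforce
  moreover have "countable ?D" using F(1) by (simp add: countable_finite)
  ultimately obtain x :: "nat \<Rightarrow> 'a" where x: "range x = ?D"
    by (metis uncountable_def)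
  have xK: "range x \<subseteq> K" using x F(2) by blast
  have "closedin (mtopology_of m) K"
    using K compactin_imp_closedin Hausdorff_space_mtopology by (simp add: mtopology_of_def)
  then have "mtopology_of m closure_of range x \<subseteq> K"
    using xK by (simp add: closure_of_minimal)
  moreover have "K \<subseteq> mtopology_of m closure_of range x"
    unfolding closure_of_mtopology_of
  proof (intro subsetI CollectI conjI allI impI)
    fix y and r :: real assume y: "y \<in> K" and "r > 0"
    then obtain n where n: "inverse (real (Suc n)) < r" using reals_Archimedean by blast
    obtain z where "z \<in> F n" "mdist m z y < inverse (Suc n)" "z \<in> mspace m"
      using F(3)[of n] y by auto
    then show "\<exists>z\<in>range x \<inter> mspace m. mdist m y z < r"
      using n x by (intro bexI[where x = z]) (auto simp: commute)
  qed (use KM in blast)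
  ultimately show ?thesis using that xK by blast
qed

lemma compactin_continuous_image_modulus:
  assumes K: "compactin (mtopology_of m1) K" and x: "range a \<subseteq> K"
    and f: "continuous_map (subtopology (mtopology_of m1) K) (mtopology_of m2) f"
  shows "\<exists>c. modulus m1 m2 a (f \<circ> a) c"
proof -
  have KM: "K \<subseteq> mspace m1" using compactin_subset_topspace[OF K] by simp
  have mK: "mspace (submetric m1 K) = K" using KM by auto
  have u: "uniformly_continuous_map (submetric m1 K) m2 f"
    using K f by (intro continuous_imp_uniformly_continuous_map)
      (simp add: mtopology_of_submetric compact_space_subtopology)
  have "\<exists>N. \<forall>j k. mdist m1 (a j) (a k) > inverse (Suc N) \<or>
      mdist m2 (f (a j)) (f (a k)) < inverse (Suc n)" for n
  proof -
    have "inverse (real (Suc n)) > 0" by simp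
    then have "\<exists>\<delta>>0. \<forall>y\<in>K. \<forall>z\<in>K. mdist m1 z y < \<delta> \<longrightarrow>
        mdist m2 (f z) (f y) < inverse (real (Suc n))"
      using u unfolding uniformly_continuous_map_def mK mdist_submetric by blast
    then obtain \<delta> where "\<delta> > 0" and \<delta>: "\<And>y z. \<lbrakk>y \<in> K; z \<in> K; mdist m1 z y < \<delta>\<rbrakk> \<Longrightarrow>
        mdist m2 (f z) (f y) < inverse (Suc n)"
      by blast
    obtain N where "inverse (real (Suc N)) < \<delta>" using \<open>\<delta> > 0\<close> reals_Archimedean by blast
    then have "mdist m1 (a j) (a k) < \<delta>" if "\<not> mdist m1 (a j) (a k) > inverse (Suc N)" for j k
      using that by linarith
    then show ?thesis using \<delta> x by (intro exI[where x = N]) blast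
  qed
  then show ?thesis unfolding modulus_def by (metis comp_apply)
qed

text \<open>Since \<open>a\<close> may repeat values, the correspondence is a function only because the modulus
  forces equal terms of \<open>a\<close> to have equal partners. Once it is, completeness of the target
  allows the uniformly continuous extension to the closure.\<close>

lemma modulus_extends_to_closure:
  assumes m2: "mcomplete_of m2" and a: "range a \<subseteq> mspace m1" and x: "range x \<subseteq> mspace m2"
    and c: "modulus m1 m2 a x c"
  obtains g where "continuous_map (subtopology (mtopology_of m1) (mtopology_of m1 closure_of range a))
      (subtopology (mtopology_of m2) (mtopology_of m2 closure_of range x)) g"
    "\<And>k. g (a k) = x k"
proof -
  have wd: "x j = x k" if "a j = a k" for j k
  proof (rule ccontr)
    assume "x j \<noteq> x k"
    then have "mdist m2 (x j) (x k) \<noteq> 0" using x by (simp add: image_subset_iff)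
    then have "mdist m2 (x j) (x k) > 0" using mdist_nonneg[of m2 "x j" "x k"] by linarith
    then obtain n where "inverse (real (Suc n)) < mdist m2 (x j) (x k)"
      using reals_Archimedean by blast
    moreover have "mdist m1 (a j) (a k) = 0" using a that by (simp add: image_subset_iff)
    then have "\<not> mdist m1 (a j) (a k) > inverse (Suc (c n))" by simp
    then have "mdist m2 (x j) (x k) < inverse (Suc n)"
      using c unfolding modulus_def by blast
    ultimately show False by simp
  qed
  define f where "f y = x (SOME k. a k = y)" for y
  have fa: "f (a k) = x k" for k
    unfolding f_def by (rule wd) (rule someI[where P = "\<lambda>j. a j = a k"], rule refl)
  have "uniformly_continuous_map (submetric m1 (range a)) m2 f"
    unfolding uniformly_continuous_map_def
  proof (intro conjI allI impI)
    show "f \<in> mspace (submetric m1 (range a)) \<rightarrow> mspace m2"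
      using fa x by auto
  next
    fix e :: real assume "e > 0"
    then obtain n where n: "inverse (real (Suc n)) < e" using reals_Archimedean by blast
    have "mdist m2 (x j) (x k) < e" if "mdist m1 (a j) (a k) < inverse (Suc (c n))" for j k
    proof -
      have "\<not> mdist m1 (a j) (a k) > inverse (Suc (c n))" using that by linarith
      then have "mdist m2 (x j) (x k) < inverse (Suc n)" using c unfolding modulus_def by blast
      then show ?thesis using n by linarith
    qed
    then show "\<exists>\<delta>>0. \<forall>y\<in>mspace (submetric m1 (range a)). \<forall>z\<in>mspace (submetric m1 (range a)).
        mdist (submetric m1 (range a)) z y < \<delta> \<longrightarrow> mdist m2 (f z) (f y) < e"
      using fa by (intro exI[where x = "inverse (Suc (c n))"]) auto
  qed
  then obtain g where g: "uniformly_continuous_map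
      (submetric m1 (mtopology_of m1 closure_of range a)) m2 g" "\<And>y. y \<in> range a \<Longrightarrow> g y = f y"
    using uniformly_continuous_map_extends_to_closure_of[OF m2] by blast
  let ?S = "subtopology (mtopology_of m1) (mtopology_of m1 closure_of range a)"
  have cont: "continuous_map ?S (mtopology_of m2) g"
    using uniformly_continuous_imp_continuous_map[OF g(1)] by (simp add: mtopology_of_submetric)
  have ga: "g (a k) = x k" for k using g(2) fa by simp
  then have gx: "g ` range a = range x" by (simp add: image_image)
  have "g ` (?S closure_of range a) \<subseteq> mtopology_of m2 closure_of range x"
    using continuous_map_image_closure_subset[OF cont, of "range a"] by (simp only: gx)
  then have "g ` (mtopology_of m1 closure_of range a) \<subseteq> mtopology_of m2 closure_of range x"
    using a by (simp only: dense_in_closure topspace_mtopology_of)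
  then have "continuous_map ?S (subtopology (mtopology_of m2) (mtopology_of m2 closure_of range x)) g"
    using cont by (auto simp: continuous_map_in_subtopology)
  then show ?thesis using that ga by blast
qed

lemma modulus_imp_homeomorphic_closures:
  assumes m: "mcomplete_of m1" "mcomplete_of m2"
    and a: "range a \<subseteq> mspace m1" and x: "range x \<subseteq> mspace m2"
    and c: "modulus m1 m2 a x c" "modulus m2 m1 x a c'"
  shows "subtopology (mtopology_of m1) (mtopology_of m1 closure_of range a) homeomorphic_space
    subtopology (mtopology_of m2) (mtopology_of m2 closure_of range x)"
    (is "?S homeomorphic_space ?T")
proof -
  obtain g where g: "continuous_map ?S ?T g" "\<And>k. g (a k) = x k"
    using modulus_extends_to_closure[OF m(2) a x c(1)] by blast
  obtain h where h: "continuous_map ?T ?S h" "\<And>k. h (x k) = a k"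
    using modulus_extends_to_closure[OF m(1) x a c(2)] by blast
  have "(h \<circ> g) y = y" if "y \<in> topspace ?S" for y
  proof (rule continuous_map_closure_eq_id[OF Hausdorff_space_mtopology_of])
    show "range a \<subseteq> topspace (mtopology_of m1)" using a by simp
    show "continuous_map ?S ?S (h \<circ> g)" by (rule continuous_map_compose[OF g(1) h(1)])
    show "(h \<circ> g) z = z" if "z \<in> range a" for z using that g(2) h(2) by auto
    show "y \<in> mtopology_of m1 closure_of range a" using that unfolding topspace_subtopology by blast
  qed
  moreover have "(g \<circ> h) y = y" if "y \<in> topspace ?T" for y
  proof (rule continuous_map_closure_eq_id[OF Hausdorff_space_mtopology_of])
    show "range x \<subseteq> topspace (mtopology_of m2)" using x by simp
    show "continuous_map ?T ?T (g \<circ> h)" by (rule continuous_map_compose[OF h(1) g(1)])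
    show "(g \<circ> h) z = z" if "z \<in> range x" for z using that g(2) h(2) by auto
    show "y \<in> mtopology_of m2 closure_of range x" using that unfolding topspace_subtopology by blast
  qed
  ultimately have "homeomorphic_maps ?S ?T g h"
    unfolding homeomorphic_maps_def comp_apply using g(1) h(1) by blast
  then show ?thesis unfolding homeomorphic_space_def by blast
qed

section \<open>The set of codes is a countable intersection of open sets\<close>

text \<open>A condition that involves a continuously varying natural number may be checked for each
  fixed value of that number, because the number is locally constant.\<close>

lemma openin_Collect_discrete:
  assumes "continuous_map W (discrete_topology UNIV) c"
    and "\<And>N. openin W {w \<in> topspace W. P N w}"
  shows "openin W {w \<in> topspace W. P (c w) w}"
proof -
  have "openin W ({w \<in> topspace W. c w \<in> {N}} \<inter> {w \<in> topspace W. P N w})" for N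
    by (intro openin_Int assms(2) openin_continuous_map_preimage[OF assms(1)]) simp
  then have "openin W (\<Union>N. {w \<in> topspace W. c w \<in> {N}} \<inter> {w \<in> topspace W. P N w})"
    by blast
  also have "(\<Union>N. {w \<in> topspace W. c w \<in> {N}} \<inter> {w \<in> topspace W. P N w}) =
      {w \<in> topspace W. P (c w) w}"
    by auto
  finally show ?thesis .
qed

lemma openin_Collect_mdist:
  assumes "continuous_map W (mtopology_of m) f" "continuous_map W (mtopology_of m) g"
  shows "openin W {w \<in> topspace W. mdist m (f w) (g w) < r}"
    and "openin W {w \<in> topspace W. mdist m (f w) (g w) > r}"
  using openin_continuous_map_preimage[OF continuous_map_mdist[OF assms], of "{..<r}"]
    openin_continuous_map_preimage[OF continuous_map_mdist[OF assms], of "{r<..}"]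
  by simp_all

lemma openin_Collect_disj:
  "\<lbrakk>openin W {w \<in> topspace W. P w}; openin W {w \<in> topspace W. Q w}\<rbrakk> \<Longrightarrow>
    openin W {w \<in> topspace W. P w \<or> Q w}"
  using openin_Un[of W "{w \<in> topspace W. P w}" "{w \<in> topspace W. Q w}"]
  by (simp add: Collect_disj_eq[symmetric] conj_disj_distribL)

lemma openin_Collect_ex:
  assumes "\<And>i. openin W {w \<in> topspace W. P i w}"
  shows "openin W {w \<in> topspace W. \<exists>i. P i w}"
proof -
  have "openin W (\<Union>i. {w \<in> topspace W. P i w})" using assms by blast
  also have "(\<Union>i. {w \<in> topspace W. P i w}) = {w \<in> topspace W. \<exists>i. P i w}" by blast
  finally show ?thesis .
qed

lemma gdelta_in_Collect_ball:
  assumes I: "countable I" and P: "\<And>i. i \<in> I \<Longrightarrow> gdelta_in W {w \<in> topspace W. P i w}"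
  shows "gdelta_in W {w \<in> topspace W. \<forall>i\<in>I. P i w}"
proof -
  have "gdelta_in W (\<Inter> (insert (topspace W) ((\<lambda>i. {w \<in> topspace W. P i w}) ` I)))"
    using I P by (intro gdelta_in_Inter) auto
  also have "\<Inter> (insert (topspace W) ((\<lambda>i. {w \<in> topspace W. P i w}) ` I)) =
      {w \<in> topspace W. \<forall>i\<in>I. P i w}"
    by blast
  finally show ?thesis .
qed

lemma gdelta_in_Collect_all:
  fixes P :: "'i::countable \<Rightarrow> 'a \<Rightarrow> bool"
  assumes "\<And>i. gdelta_in W {w \<in> topspace W. P i w}"
  shows "gdelta_in W {w \<in> topspace W. \<forall>i. P i w}"
  using gdelta_in_Collect_ball[of UNIV W P] assms by simp

lemma gdelta_in_Collect_conj:
  "\<lbrakk>gdelta_in W {w \<in> topspace W. P w}; gdelta_in W {w \<in> topspace W. Q w}\<rbrakk> \<Longrightarrow>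
    gdelta_in W {w \<in> topspace W. P w \<and> Q w}"
  using gdelta_in_Int[of W "{w \<in> topspace W. P w}" "{w \<in> topspace W. Q w}"]
  by (simp add: Collect_conj_eq[symmetric] conj_commute conj_left_commute)

lemma gdelta_in_uniformly_spread:
  assumes x: "\<And>k. continuous_map W (mtopology_of m) (\<lambda>w. x w k)"
    and c: "\<And>n. continuous_map W (discrete_topology UNIV) (\<lambda>w. c w n)"
  shows "gdelta_in W {w \<in> topspace W. uniformly_spread m (x w) (c w)}"
  unfolding uniformly_spread_def
proof (intro gdelta_in_Collect_all open_imp_gdelta_in)
  fix n k
  have "openin W {w \<in> topspace W. j \<le> N \<and> mdist m (x w k) (x w j) < inverse (Suc n)}" for j N
    using openin_Collect_mdist(1)[OF x x] by (cases "j \<le> N") simp_all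
  then have "openin W {w \<in> topspace W. \<exists>j\<le>N. mdist m (x w k) (x w j) < inverse (Suc n)}" for N
    by (rule openin_Collect_ex)
  then show "openin W {w \<in> topspace W. \<exists>j\<le>c w n. mdist m (x w k) (x w j) < inverse (Suc n)}"
    by (rule openin_Collect_discrete[OF c])
qed

lemma gdelta_in_modulus:
  assumes a: "\<And>k. continuous_map W (mtopology_of m1) (\<lambda>w. a w k)"
    and x: "\<And>k. continuous_map W (mtopology_of m2) (\<lambda>w. x w k)"
    and c: "\<And>n. continuous_map W (discrete_topology UNIV) (\<lambda>w. c w n)"
  shows "gdelta_in W {w \<in> topspace W. modulus m1 m2 (a w) (x w) (c w)}"
  unfolding modulus_def
proof (intro gdelta_in_Collect_all open_imp_gdelta_in)
  fix n j k
  have "openin W {w \<in> topspace W. mdist m1 (a w j) (a w k) > inverse (Suc N) \<or>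
      mdist m2 (x w j) (x w k) < inverse (Suc n)}" for N
    by (intro openin_Collect_disj openin_Collect_mdist a x)
  then show "openin W {w \<in> topspace W. mdist m1 (a w j) (a w k) > inverse (Suc (c w n)) \<or>
      mdist m2 (x w j) (x w k) < inverse (Suc n)}"
    by (rule openin_Collect_discrete[OF c])
qed

definition fills_fibre :: "'a topology \<Rightarrow> ('a \<Rightarrow> 'b) \<Rightarrow> (nat \<Rightarrow> 'a) \<Rightarrow> bool"
  where "fills_fibre A q a \<longleftrightarrow> range a \<subseteq> topspace A \<and>
    A closure_of range a = {y \<in> topspace A. q y = q (a 0)}"

text \<open>Given that \<open>q\<close> is constant on \<open>a\<close>, the fibre contains the closure of the range because
  points of \<open>B\<close> are closed. The other inclusion is density in the fibre, and a basic open set \<open>U\<close> meets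
  the fibre exactly when \<open>q (a 0)\<close> lies in \<open>q ` U\<close>. This form speaks of the fibre only
  through the sets \<open>q ` U\<close>, which are open when \<open>q\<close> is an open map.\<close>

lemma fills_fibre_iff_base:
  assumes q: "continuous_map A B q" and B: "t1_space B" and a: "range a \<subseteq> topspace A"
    and \<B>: "\<And>U. U \<in> \<B> \<Longrightarrow> openin A U"
      "\<And>U y. \<lbrakk>openin A U; y \<in> U\<rbrakk> \<Longrightarrow> \<exists>V\<in>\<B>. y \<in> V \<and> V \<subseteq> U"
  shows "fills_fibre A q a \<longleftrightarrow>
    (\<forall>k. q (a k) = q (a 0)) \<and> (\<forall>U\<in>\<B>. q (a 0) \<in> q ` U \<longrightarrow> (\<exists>k. a k \<in> U))"
    (is "_ \<longleftrightarrow> ?R")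
proof
  assume *: "fills_fibre A q a"
  show ?R
  proof (intro conjI allI ballI impI)
    have "range a \<subseteq> A closure_of range a" using a by (rule closure_of_subset)
    then show "q (a k) = q (a 0)" for k
      using * unfolding fills_fibre_def by blast
  next
    fix U assume U: "U \<in> \<B>" "q (a 0) \<in> q ` U"
    then obtain y where y: "y \<in> U" "q y = q (a 0)" by auto
    then have "y \<in> A closure_of range a"
      using * openin_subset[OF \<B>(1)[OF U(1)]] unfolding fills_fibre_def by blast
    then show "\<exists>k. a k \<in> U"
      using y(1) \<B>(1)[OF U(1)] unfolding in_closure_of by blast
  qed
next
  assume R: ?R
  let ?F = "{y \<in> topspace A. q y = q (a 0)}"
  have "q (a 0) \<in> topspace B"
    using q a continuous_map_image_subset_topspace by fastforce
  then have "closedin B {q (a 0)}" using B by (simp add: closedin_t1_singleton)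
  then have "closedin A ?F" using closedin_continuous_map_preimage[OF q] by fastforce
  moreover have "range a \<subseteq> ?F" using R a by auto
  ultimately have "A closure_of range a \<subseteq> ?F" by (simp add: closure_of_minimal)
  moreover have "?F \<subseteq> A closure_of range a"
  proof
    fix y assume y: "y \<in> ?F"
    show "y \<in> A closure_of range a"
      unfolding in_closure_of
    proof (intro conjI allI impI)
      fix T assume "y \<in> T \<and> openin A T"
      then obtain V where V: "V \<in> \<B>" "y \<in> V" "V \<subseteq> T" using \<B>(2) by blast
      moreover have "q (a 0) \<in> q ` V" using y V(2) by (metis (mono_tags, lifting) image_eqI mem_Collect_eq)
      ultimately obtain k where "a k \<in> V" using R by blast
      then show "\<exists>z. z \<in> range a \<and> z \<in> T" using V(3) by blast
    qed (use y in blast)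
  qed
  ultimately show "fills_fibre A q a" using a unfolding fills_fibre_def by blast
qed

lemma gdelta_in_fills_fibre:
  assumes A: "second_countable A" and B: "Hausdorff_space B" and W: "metrizable_space W"
    and q: "continuous_map A B q" "open_map A B q"
    and a: "\<And>k. continuous_map W A (\<lambda>w. a w k)"
  shows "gdelta_in W {w \<in> topspace W. fills_fibre A q (a w)}"
proof -
  obtain \<B> where \<B>: "countable \<B>" "\<And>U. U \<in> \<B> \<Longrightarrow> openin A U"
    "\<And>U y. \<lbrakk>openin A U; y \<in> U\<rbrakk> \<Longrightarrow> \<exists>V\<in>\<B>. y \<in> V \<and> V \<subseteq> U"
    using A unfolding second_countable_def by metis
  have qa: "continuous_map W B (\<lambda>w. q (a w k))" for k
    using continuous_map_compose[OF a q(1)] by (simp add: comp_def)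
  have range: "range (a w) \<subseteq> topspace A" if "w \<in> topspace W" for w
    using continuous_map_funspace[OF a] that by blast
  have "gdelta_in W {w \<in> topspace W. (\<forall>k. q (a w k) = q (a w 0)) \<and>
      (\<forall>U\<in>\<B>. q (a w 0) \<notin> q ` U \<or> (\<exists>k. a w k \<in> U))}"
  proof (intro gdelta_in_Collect_conj gdelta_in_Collect_all gdelta_in_Collect_ball \<B>(1))
    show "gdelta_in W {w \<in> topspace W. q (a w k) = q (a w 0)}" for k
      by (rule closed_imp_gdelta_in[OF W closedin_continuous_maps_eq[OF B qa qa]])
  next
    fix U assume U: "U \<in> \<B>"
    have "openin B (q ` U)" using q(2) \<B>(2)[OF U] unfolding open_map_def by blast
    then have "openin W {w \<in> topspace W. q (a w 0) \<in> q ` U}"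
      by (rule openin_continuous_map_preimage[OF qa])
    then have "closedin W (topspace W - {w \<in> topspace W. q (a w 0) \<in> q ` U})" by blast
    moreover have "openin W {w \<in> topspace W. \<exists>k. a w k \<in> U}"
      by (intro openin_Collect_ex openin_continuous_map_preimage[OF a] \<B>(2) U)
    ultimately have "gdelta_in W ((topspace W - {w \<in> topspace W. q (a w 0) \<in> q ` U}) \<union>
        {w \<in> topspace W. \<exists>k. a w k \<in> U})"
      by (intro gdelta_in_Un closed_imp_gdelta_in[OF W] open_imp_gdelta_in)
    also have "(topspace W - {w \<in> topspace W. q (a w 0) \<in> q ` U}) \<union>
        {w \<in> topspace W. \<exists>k. a w k \<in> U} =
        {w \<in> topspace W. q (a w 0) \<notin> q ` U \<or> (\<exists>k. a w k \<in> U)}"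
      by blast
    finally show "gdelta_in W {w \<in> topspace W. q (a w 0) \<notin> q ` U \<or> (\<exists>k. a w k \<in> U)}" .
  qed
  also have "{w \<in> topspace W. (\<forall>k. q (a w k) = q (a w 0)) \<and>
      (\<forall>U\<in>\<B>. q (a w 0) \<notin> q ` U \<or> (\<exists>k. a w k \<in> U))} =
      {w \<in> topspace W. fills_fibre A q (a w)}"
  proof (intro Collect_cong conj_cong refl)
    fix w assume w: "w \<in> topspace W"
    have "fills_fibre A q (a w) \<longleftrightarrow>
        (\<forall>k. q (a w k) = q (a w 0)) \<and> (\<forall>U\<in>\<B>. q (a w 0) \<in> q ` U \<longrightarrow> (\<exists>k. a w k \<in> U))"
      using \<B>(2,3) by (intro fills_fibre_iff_base[OF q(1) Hausdorff_imp_t1_space[OF B] range[OF w]])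
    then show "((\<forall>k. q (a w k) = q (a w 0)) \<and> (\<forall>U\<in>\<B>. q (a w 0) \<notin> q ` U \<or> (\<exists>k. a w k \<in> U))) =
        fills_fibre A q (a w)"
      by (simp only: imp_conv_disj)
  qed
  finally show ?thesis .
qed

section \<open>Continuity into the hyperspace\<close>

text \<open>The Lebesgue number argument: cover \<open>K\<close> by finitely many balls of half the radius that
  still fits into \<open>U\<close>.\<close>

lemma compactin_imp_uniform_neighbourhood:
  assumes K: "compactin (mtopology_of m) K" and U: "openin (mtopology_of m) U" "K \<subseteq> U"
  obtains e where "e > 0" "\<And>y z. \<lbrakk>y \<in> K; z \<in> mspace m; mdist m y z < e\<rbrakk> \<Longrightarrow> z \<in> U"
proof -
  interpret Metric_space "mspace m" "mdist m" by (rule Metric_space_mspace_mdist)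
  have KM: "K \<subseteq> mspace m" using compactin_subset_topspace[OF K] by simp
  have "\<forall>y\<in>K. \<exists>r>0. mball y r \<subseteq> U"
    using U unfolding mtopology_of_def openin_mtopology by blast
  then obtain r where r: "\<And>y. y \<in> K \<Longrightarrow> r y > 0" "\<And>y. y \<in> K \<Longrightarrow> mball y (r y) \<subseteq> U" by metis
  let ?V = "\<lambda>y. mball y (r y / 2)"
  have "\<And>V. V \<in> ?V ` K \<Longrightarrow> openin (mtopology_of m) V"
    by (auto simp: mtopology_of_def)
  moreover have "K \<subseteq> \<Union> (?V ` K)"
  proof
    fix y assume y: "y \<in> K"
    then have "y \<in> ?V y" using KM r(1)[OF y] by auto
    then show "y \<in> \<Union> (?V ` K)" using y by blast
  qed
  ultimately have "\<exists>\<F>. finite \<F> \<and> \<F> \<subseteq> ?V ` K \<and> K \<subseteq> \<Union> \<F>"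
    by (rule compactinD[OF K])
  then obtain \<F> where F: "finite \<F>" "\<F> \<subseteq> ?V ` K" "K \<subseteq> \<Union> \<F>" by blast
  obtain C where C: "C \<subseteq> K" "finite C" "\<F> = ?V ` C"
    using finite_subset_image[OF F(1,2)] by blast
  define e where "e = Min (insert 1 ((\<lambda>y. r y / 2) ` C))"
  have e: "e > 0"
    using C r(1) by (auto simp: e_def)
  have e_le: "e \<le> r y / 2" if "y \<in> C" for y
    unfolding e_def using C(2) that by (intro Min_le) auto
  have "z \<in> U" if y: "y \<in> K" and z: "z \<in> mspace m" "mdist m y z < e" for y z
  proof -
    obtain u where u: "u \<in> C" "u \<in> mspace m" "mdist m u y < r u / 2"
      using F(3) C(3) y by auto
    have "mdist m u z \<le> mdist m u y + mdist m y z"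
      using u y z KM by (intro triangle) auto
    then have "z \<in> mball u (r u)" using u z e_le[OF u(1)] by auto
    then show "z \<in> U" using r(2) C(1) u(1) by blast
  qed
  then show ?thesis using that e by blast
qed

text \<open>The closure of the range meets an open \<open>U\<close> exactly when some term of the sequence lies in
  \<open>U\<close>. For the sets \<open>{K. K \<subseteq> U}\<close>, some \<open>e\<close>-neighbourhood of the compact closure
  lies in \<open>U\<close>, and for a precision finer than \<open>e/3\<close> the finitely many terms up to
  \<open>c w n\<close> control the whole sequence, also for every nearby code, as \<open>c\<close> has the
  same value at \<open>n\<close> there.\<close>

lemma continuous_map_closure_range_Vietoris:
  assumes m: "mcomplete_of m"
    and x: "\<And>k. continuous_map W (mtopology_of m) (\<lambda>w. x w k)"
    and c: "\<And>n. continuous_map W (discrete_topology UNIV) (\<lambda>w. c w n)"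
    and spread: "\<And>w. w \<in> topspace W \<Longrightarrow> uniformly_spread m (x w) (c w)"
  shows "continuous_map W (Vietoris (mtopology_of m))
    (\<lambda>w. mtopology_of m closure_of range (x w))"
    (is "continuous_map _ (Vietoris ?X) ?K")
proof -
  interpret Metric_space "mspace m" "mdist m" by (rule Metric_space_mspace_mdist)
  have range: "range (x w) \<subseteq> mspace m" if "w \<in> topspace W" for w
    using continuous_map_funspace[OF x] that by auto
  have K: "compactin ?X (?K w)" if "w \<in> topspace W" for w
    using uniformly_spread_imp_compactin_closure[OF m range[OF that] spread[OF that]] .
  have hit: "openin W (?K -` {K. compactin ?X K \<and> K \<inter> U \<noteq> {}} \<inter> topspace W)"
    if U: "openin ?X U" for U
  proof -
    have "?K w \<inter> U \<noteq> {} \<longleftrightarrow> (\<exists>k. x w k \<in> U)" if "w \<in> topspace W" for w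
      using openin_Int_closure_of_eq_empty[OF U, of "range (x w)"] by blast
    then have "?K -` {K. compactin ?X K \<and> K \<inter> U \<noteq> {}} \<inter> topspace W =
        {w \<in> topspace W. \<exists>k. x w k \<in> U}"
      using K by blast
    moreover have "openin W {w \<in> topspace W. \<exists>k. x w k \<in> U}"
      by (intro openin_Collect_ex openin_continuous_map_preimage[OF x] U)
    ultimately show ?thesis by simp
  qed
  have inside: "openin W (?K -` {K. compactin ?X K \<and> K \<subseteq> U} \<inter> topspace W)" (is "openin W ?S")
    if U: "openin ?X U" for U
  proof (subst openin_subopen, intro ballI)
    fix w assume w: "w \<in> ?S"
    then have wW: "w \<in> topspace W" and KU: "?K w \<subseteq> U" by auto
    obtain e where e: "e > 0" "\<And>y z. \<lbrakk>y \<in> ?K w; z \<in> mspace m; mdist m y z < e\<rbrakk> \<Longrightarrow> z \<in> U"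
      using compactin_imp_uniform_neighbourhood[OF K[OF wW] U KU] by blast
    obtain n where n: "inverse (real (Suc n)) < e / 3"
      using reals_Archimedean[of "e/3"] e(1) by auto
    \<comment> \<open>Three errors of size \<open>e / 3\<close> add up for a code in this neighbourhood: from a point of the new
      closure to a term of its sequence, to a term of index at most \<open>c w n\<close>, to its old
      position.\<close>
    let ?N = "{v \<in> topspace W. c v n \<in> {c w n}} \<inter>
        (\<Inter>j\<in>{..c w n}. {v \<in> topspace W. mdist m (x v j) (x w j) < e / 3})"
    have cst: "continuous_map W ?X (\<lambda>v. x w j)" for j using range[OF wW] by auto
    have "openin W ?N"
      by (intro openin_Int openin_INT2 openin_continuous_map_preimage[OF c]
          openin_Collect_mdist(1)[OF x cst]) auto
    moreover have "w \<in> ?N"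
    proof -
      have "mdist m (x w j) (x w j) < e / 3" for j
        using range[OF wW] e(1) by (simp add: image_subset_iff)
      then show ?thesis using wW by simp
    qed
    moreover have "?N \<subseteq> ?S"
    proof
      fix v assume v: "v \<in> ?N"
      then have vW: "v \<in> topspace W" and cv: "c v n = c w n"
        and near: "\<And>j. j \<le> c w n \<Longrightarrow> mdist m (x v j) (x w j) < e / 3"
        by auto
      have "?K v \<subseteq> U"
      proof
        fix z assume z: "z \<in> ?K v"
        then have zM: "z \<in> mspace m" unfolding closure_of_mtopology_of by blast
        have "e / 3 > 0" using e(1) by simp
        then obtain k where k: "mdist m z (x v k) < e / 3"
          using z unfolding closure_of_mtopology_of by blast
        obtain j where j: "j \<le> c v n" "mdist m (x v k) (x v j) < inverse (Suc n)"
          using spread[OF vW] unfolding uniformly_spread_def by blast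
        have M: "x v k \<in> mspace m" "x v j \<in> mspace m" "x w j \<in> mspace m"
          using range vW wW by auto
        have "mdist m z (x w j) \<le> mdist m z (x v k) + mdist m (x v k) (x w j)"
          using zM M by (intro triangle)
        also have "mdist m (x v k) (x w j) \<le> mdist m (x v k) (x v j) + mdist m (x v j) (x w j)"
          using M by (intro triangle)
        finally have "mdist m (x w j) z < e"
          using k j(2) near[of j] j(1) cv n by (simp add: commute)
        moreover have "x w j \<in> ?K w"
          using closure_of_subset[of "range (x w)" ?X] range[OF wW] by auto
        ultimately show "z \<in> U" using e(2) zM by blast
      qed
      then show "v \<in> ?S" using vW K by blast
    qed
    ultimately show "\<exists>T. openin W T \<and> w \<in> T \<and> T \<subseteq> ?S" by blast
  qed
  show ?thesis
    unfolding Vietoris_def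
  proof (rule continuous_on_generated_topo)
    show "openin W (?K -` V \<inter> topspace W)"
      if "V \<in> {{K. compactin ?X K \<and> K \<inter> U \<noteq> {}} | U. openin ?X U} \<union>
        {{K. compactin ?X K \<and> K \<subseteq> U} | U. openin ?X U}" for V
      using that hit inside by blast
    show "?K ` topspace W \<subseteq> \<Union> ({{K. compactin ?X K \<and> K \<inter> U \<noteq> {}} | U. openin ?X U} \<union>
        {{K. compactin ?X K \<and> K \<subseteq> U} | U. openin ?X U})"
      using K topspace_Vietoris[of ?X] unfolding Vietoris_def topology_generated_by_topspace by blast
  qed
qed


section \<open>Compact copies of the fibres of an open map\<close>

lemma completely_metrizable_space_mtopology_of:
  assumes "completely_metrizable_space X"
  obtains m where "X = mtopology_of m" "mcomplete_of m"
proof -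
  obtain M d where M: "Metric_space M d" "Metric_space.mcomplete M d" "X = Metric_space.mtopology M d"
    using assms unfolding completely_metrizable_space_def by blast
  then show ?thesis
    using that[of "metric (M, d)"] Metric_space.mtopology_of Metric_space.mcomplete_of by metis
qed

text \<open>Each nonempty compact copy of a fibre is read off as the closure of \<open>x\<close> from a code
  \<open>(a, x, c)\<close>. Compactness is imposed only on the closure of \<open>x\<close>; the fibre, being the closure of
  \<open>a\<close>, inherits it through the homeomorphism.\<close>

lemma analytic_in_copies_of_nonempty_fibres:
  assumes A: "Polish_space A" and B: "Hausdorff_space B"
    and q: "continuous_map A B q" "open_map A B q" and X: "Polish_space X"
  shows "analytic_in (Vietoris X) {K. compactin X K \<and> K \<noteq> {} \<and>
    (\<exists>b\<in>topspace B. subtopology X K homeomorphic_space subtopology A {a \<in> topspace A. q a = b})}"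
    (is "analytic_in _ ?S")
proof -
  obtain m1 where m1: "A = mtopology_of m1" "mcomplete_of m1"
    using A completely_metrizable_space_mtopology_of unfolding Polish_space_def by metis
  obtain m2 where m2: "X = mtopology_of m2" "mcomplete_of m2"
    using X completely_metrizable_space_mtopology_of unfolding Polish_space_def by metis
  let ?W = "prod_topology (sequence_space A) (prod_topology (sequence_space X)
      (sequence_space (discrete_topology (UNIV :: nat set))))"
  define code where "code w \<longleftrightarrow> fills_fibre A q (fst w) \<and>
      uniformly_spread m2 (fst (snd w)) (snd (snd w)) \<and>
      modulus m1 m2 (fst w) (fst (snd w)) (snd (snd w)) \<and>
      modulus m2 m1 (fst (snd w)) (fst w) (snd (snd w))" for w
  let ?Z = "subtopology ?W {w \<in> topspace ?W. code w}"
  let ?K = "\<lambda>w. mtopology_of m2 closure_of range (fst (snd w))"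
  have W: "Polish_space ?W"
    by (intro Polish_space_prod_topology Polish_space_sequence_space A X
        Polish_space_discrete_topology) simp
  have proj: "continuous_map (sequence_space Y) Y (\<lambda>y. y k)" for Y :: "'e topology" and k
    by (rule continuous_map_product_projection) simp
  have a: "continuous_map ?W (mtopology_of m1) (\<lambda>w. fst w k)" for k
    using continuous_map_compose[OF continuous_map_fst proj] m1(1) by (simp add: comp_def)
  have x: "continuous_map ?W (mtopology_of m2) (\<lambda>w. fst (snd w) k)" for k
    using continuous_map_compose[OF continuous_map_snd
        continuous_map_compose[OF continuous_map_fst proj]] m2(1) by (simp add: comp_def)
  have c: "continuous_map ?W (discrete_topology UNIV) (\<lambda>w. snd (snd w) k)" for k
    using continuous_map_compose[OF continuous_map_snd
        continuous_map_compose[OF continuous_map_snd proj]] by (simp add: comp_def)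
  have "gdelta_in ?W {w \<in> topspace ?W. code w}"
    unfolding code_def
  proof (intro gdelta_in_Collect_conj gdelta_in_uniformly_spread gdelta_in_modulus a x c)
    show "gdelta_in ?W {w \<in> topspace ?W. fills_fibre A q (fst w)}"
    proof (rule gdelta_in_fills_fibre[OF _ B _ q])
      show "second_countable A" using A Polish_space_iff_second_countable by blast
      show "metrizable_space ?W"
        using W completely_metrizable_imp_metrizable_space unfolding Polish_space_def by blast
      show "continuous_map ?W A (\<lambda>w. fst w k)" for k using a m1(1) by simp
    qed
  qed
  then have Z: "Polish_space ?Z" by (rule Polish_space_gdelta_subtopology[OF W])
  have "continuous_map ?Z (Vietoris (mtopology_of m2)) ?K"
  proof (rule continuous_map_closure_range_Vietoris[OF m2(2)])
    show "continuous_map ?Z (mtopology_of m2) (\<lambda>w. fst (snd w) k)" for k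
      by (rule continuous_map_from_subtopology[OF x])
    show "continuous_map ?Z (discrete_topology UNIV) (\<lambda>w. snd (snd w) n)" for n
      by (rule continuous_map_from_subtopology[OF c])
    show "uniformly_spread m2 (fst (snd w)) (snd (snd w))" if "w \<in> topspace ?Z" for w
      using that by (simp add: code_def)
  qed
  then have "analytic_in (Vietoris X) (?K ` topspace ?Z)"
    unfolding m2(1)[symmetric] by (rule analytic_inI[OF Z])
  also have "?K ` topspace ?Z = ?S"
  proof (intro equalityI subsetI)
    fix K assume "K \<in> ?K ` topspace ?Z"
    then obtain w where wW: "w \<in> topspace ?W" and w: "code w" and K: "K = ?K w" by auto
    have ra: "range (fst w) \<subseteq> mspace m1" and rx: "range (fst (snd w)) \<subseteq> mspace m2"
      using continuous_map_funspace[OF a] continuous_map_funspace[OF x] wW by auto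
    have "compactin X K"
      using uniformly_spread_imp_compactin_closure[OF m2(2) rx] w unfolding K m2(1) code_def by blast
    moreover have "K \<noteq> {}"
      using closure_of_subset[of "range (fst (snd w))" "mtopology_of m2"] rx unfolding K by auto
    moreover have "subtopology X K homeomorphic_space
        subtopology A {a \<in> topspace A. q a = q (fst w 0)}"
    proof -
      have "A closure_of range (fst w) = {a \<in> topspace A. q a = q (fst w 0)}"
        using w unfolding code_def fills_fibre_def by blast
      moreover have "subtopology X K homeomorphic_space subtopology A (A closure_of range (fst w))"
        using modulus_imp_homeomorphic_closures[OF m2(2) m1(2) rx ra] w
        unfolding code_def K m1(1) m2(1) by blast
      ultimately show ?thesis by simp
    qed
    moreover have "q (fst w 0) \<in> topspace B"
      using continuous_map_funspace[OF q(1)] ra m1(1) by auto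
    ultimately show "K \<in> ?S" by blast
  next
    fix K assume "K \<in> ?S"
    then obtain b where K: "compactin X K" "K \<noteq> {}"
      and b: "subtopology X K homeomorphic_space subtopology A {a \<in> topspace A. q a = b}"
        (is "_ homeomorphic_space subtopology A ?F")
      by blast
    obtain g h where gh: "homeomorphic_maps (subtopology X K) (subtopology A ?F) g h"
      using b unfolding homeomorphic_space_def by blast
    have KX: "topspace (subtopology X K) = K"
      using compactin_subset_topspace[OF K(1)] by auto
    have FA: "topspace (subtopology A ?F) = ?F" by auto
    have g: "continuous_map (subtopology X K) (subtopology A ?F) g"
      and h: "continuous_map (subtopology A ?F) (subtopology X K) h"
      and hg: "\<And>y. y \<in> K \<Longrightarrow> h (g y) = y" and gh': "\<And>y. y \<in> ?F \<Longrightarrow> g (h y) = y"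
      using gh unfolding homeomorphic_maps_def KX FA by auto
    have gA: "continuous_map (subtopology X K) A g" and hX: "continuous_map (subtopology A ?F) X h"
      using g h continuous_map_into_fulltopology by blast+
    have gK: "g ` K = ?F"
      using continuous_map_funspace[OF g] continuous_map_funspace[OF h] gh'
      unfolding KX FA by (auto simp: Pi_iff image_iff) metis
    obtain x :: "nat \<Rightarrow> _" where x: "range x \<subseteq> K" "X closure_of range x = K"
      using compactin_imp_dense_sequence[OF K(1)[unfolded m2(1)] K(2)] unfolding m2(1) by blast
    define a where "a = g \<circ> x"
    have ha: "h \<circ> a = x" using hg x(1) unfolding a_def by (auto simp: fun_eq_iff)
    have aF: "range a \<subseteq> ?F" unfolding a_def using gK x(1) by auto
    have F: "compactin A ?F"
      using image_compactin[OF _ gA, of K] K(1) gK by (simp add: compactin_subtopology)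
    obtain c1 where c1: "uniformly_spread m2 x c1"
      using compactin_dense_sequence_uniformly_spread[of m2 K x] K(1) x m2(1) by auto
    obtain c2 where c2: "modulus m2 m1 x a c2"
      using compactin_continuous_image_modulus[of m2 K x m1 g] K(1) x(1) gA m1(1) m2(1)
      unfolding a_def by auto
    obtain c3 where c3: "modulus m1 m2 a x c3"
      using compactin_continuous_image_modulus[of m1 ?F a m2 h] F aF hX m1(1) m2(1) ha by auto
    \<comment> \<open>All three conditions survive enlarging \<open>c\<close>, so the sum of the three bounds
      satisfies them simultaneously.\<close>
    define c where "c n = c1 n + c2 n + c3 n" for n
    have fills: "fills_fibre A q a"
    proof -
      have "closedin A ?F"
        using compactin_imp_closedin[OF _ F] Hausdorff_space_mtopology_of m1(1) by metis
      then have "A closure_of range a \<subseteq> ?F" using aF by (simp add: closure_of_minimal)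
      moreover have "?F \<subseteq> A closure_of range a"
      proof -
        have "K \<inter> range x = range x" using x(1) by blast
        then have "subtopology X K closure_of range x = K"
          using x(2) by (simp add: closure_of_subtopology)
        then have "g ` K \<subseteq> A closure_of (g ` range x)"
          using continuous_map_image_closure_subset[OF gA, of "range x"] by simp
        then show ?thesis unfolding gK a_def by (simp add: image_comp)
      qed
      moreover have "q (a 0) = b" using aF by auto
      ultimately show ?thesis unfolding fills_fibre_def using aF by auto
    qed
    have "code (a, x, c)"
      unfolding code_def fst_conv snd_conv
      using fills uniformly_spread_mono[OF c1, of c] modulus_mono[OF c2, of c]
        modulus_mono[OF c3, of c] by (simp add: c_def)
    moreover have "(a, x, c) \<in> topspace ?W"
    proof -
      have "range a \<subseteq> topspace A" "range x \<subseteq> topspace X"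
        using aF x(1) compactin_subset_topspace[OF K(1)] by auto
      then show ?thesis by (simp add: PiE_iff image_subset_iff)
    qed
    ultimately have "(a, x, c) \<in> topspace ?Z" by simp
    then have "?K (a, x, c) \<in> ?K ` topspace ?Z" by (rule imageI)
    moreover have "?K (a, x, c) = K" using x(2) unfolding m2(1) by simp
    ultimately show "K \<in> ?K ` topspace ?Z" by (rule back_subst)
  qed
  finally show ?thesis .
qed

text \<open>Equivalence of classes replaces members of \<open>\<C>\<close> by fibres. The empty set may or may not
  belong to the result, according to whether some member of \<open>\<C>\<close> is empty; it is added at the
  end.\<close>

theorem theorem4p26:
  fixes \<C> :: "'c topology set" and X :: "'x topology"
  assumes "strongly_Polishable \<C>"
    and "\<forall>Y\<in>\<C>. compact_space Y"
    and "Polish_space X"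
  shows "analytic_in (Vietoris X)
    {K. compactin X K \<and> (\<exists>Y\<in>\<C>. subtopology X K homeomorphic_space Y)}"
    (is "analytic_in _ ?S")
proof -
  obtain A B :: "nat set topology" and q where A: "Polish_space A" and B: "Polish_space B"
    and q: "continuous_map A B q" "open_map A B q"
    and eqv: "equivalent_classes (fibres A B q) \<C>"
    using assms(1) unfolding strongly_Polishable_def strong_Polish_presentation_def by blast
  let ?fibre = "\<lambda>b. subtopology A {a \<in> topspace A. q a = b}"
  have "Hausdorff_space B"
    using B completely_metrizable_imp_metrizable_space metrizable_imp_Hausdorff_space
    unfolding Polish_space_def by blast
  note nonempty = analytic_in_copies_of_nonempty_fibres[OF A this q assms(3)]
  have "(\<exists>Y\<in>\<C>. subtopology X K homeomorphic_space Y) \<longleftrightarrow>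
      (\<exists>b\<in>topspace B. subtopology X K homeomorphic_space ?fibre b)" for K
  proof
    assume "\<exists>Y\<in>\<C>. subtopology X K homeomorphic_space Y"
    then obtain Y where Y: "Y \<in> \<C>" "subtopology X K homeomorphic_space Y" by blast
    then obtain b where "b \<in> topspace B" "Y homeomorphic_space ?fibre b"
      using eqv unfolding equivalent_classes_def fibres_def by blast
    then show "\<exists>b\<in>topspace B. subtopology X K homeomorphic_space ?fibre b"
      using homeomorphic_space_trans[OF Y(2)] by blast
  next
    assume "\<exists>b\<in>topspace B. subtopology X K homeomorphic_space ?fibre b"
    then obtain b where b: "b \<in> topspace B" "subtopology X K homeomorphic_space ?fibre b" by blast
    then obtain Y where "Y \<in> \<C>" "?fibre b homeomorphic_space Y"
      using eqv unfolding equivalent_classes_def fibres_def by blast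
    then show "\<exists>Y\<in>\<C>. subtopology X K homeomorphic_space Y"
      using homeomorphic_space_trans[OF b(2)] by blast
  qed
  then have "{K. compactin X K \<and> K \<noteq> {} \<and>
      (\<exists>b\<in>topspace B. subtopology X K homeomorphic_space ?fibre b)} = ?S - {{}}"
    by blast
  with nonempty have D: "analytic_in (Vietoris X) (?S - {{}})" by (simp only:)
  show ?thesis
  proof (cases "{} \<in> ?S")
    case True
    have "analytic_in (Vietoris X) (insert {} (?S - {{}}))"
      by (rule analytic_in_insert[OF D]) (simp add: topspace_Vietoris)
    moreover have "insert {} (?S - {{}}) = ?S" using True by blast
    ultimately show ?thesis by (rule back_subst)
  next
    case False
    then have "?S - {{}} = ?S" by blast
    then show ?thesis using D by (simp only:)
  qed
qed

end
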